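(* Let $w_{021}(n)$ be the number of weak ascent sequences of length $n$ that avoid the pattern $021$. The generating function $F_{021}(x)=\sum_{n\ge 0} w_{021}(n)\,x^n$ satisfies $$F_{021}(x)=1+\frac{xF_{021}(x)}{1-xF_{021}(x)^2},$$ which implies $$F_{021}(x)-1=-\frac{xv_0^2-v_0+x+1}{x},$$ where $$v_0=\frac{2\sqrt{1-4x-2x^2}}{3x}\cos\left(-\frac{1}{3}\arccos\left(\frac{7x^3-6x^2+12x-2}{2(1-4x-2x^2)^{3/2}}\right)+\frac{\pi}{3}\right)+\frac{x+1}{3x}.$$
   Context: For a word $u=u_1\cdots u_\ell$ of non-negative integers, $\mathrm{wasc}(u)$ denotes the number of weak ascents of $u$, i.e. the number of positions $j$ with $1\le j\le \ell-1$ and $u_j\le u_{j+1}$. A weak ascent sequence of length $n\ge 1$ is a word $w=w_1w_2\cdots w_n$ of non-negative integers with $w_1=0$ and $w_i\le \mathrm{wasc}(w_1\cdots w_{i-1})+1$ for $i=2,\dots,n$; the empty word is the unique weak ascent sequence of length $0$. The word $w$ contains a pattern $p=p_1\cdots p_k$ if there are indices $i_1<\cdots<i_k$ such that $w_{i_1}\cdots w_{i_k}$ is order-isomorphic to $p$ (for all $a,b$: $w_{i_a}<w_{i_b}$ iff $p_a<p_b$, and $w_{i_a}=w_{i_b}$ iff $p_a=p_b$); otherwise $w$ avoids $p$. Here $\arccos$ denotes the usual inverse cosine. *)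

theory Defs
  imports "HOL-Analysis.Analysis"
begin

text \<open>Words are lists of naturals; list positions count from 0, so \<open>w ! i\<close> is the letter
  $w_{i+1}$ and \<open>take i w\<close> is the prefix $w_1 \cdots w_i$ preceding it.\<close>

definition wasc :: "nat list \<Rightarrow> nat" where
  "wasc u = card {j. Suc j < length u \<and> u ! j \<le> u ! Suc j}"

definition weak_ascent_seq :: "nat list \<Rightarrow> bool" where
  "weak_ascent_seq w \<longleftrightarrow>
     (w \<noteq> [] \<longrightarrow> w ! 0 = 0) \<and>
     (\<forall>i. 0 < i \<and> i < length w \<longrightarrow> w ! i \<le> wasc (take i w) + 1)"

definition contains_pattern :: "nat list \<Rightarrow> nat list \<Rightarrow> bool" where
  "contains_pattern w p \<longleftrightarrow>
     (\<exists>f :: nat \<Rightarrow> nat.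
        strict_mono_on {..<length p} f \<and>
        (\<forall>a < length p. f a < length w) \<and>
        (\<forall>a < length p. \<forall>b < length p.
           (w ! f a < w ! f b \<longleftrightarrow> p ! a < p ! b) \<and>
           (w ! f a = w ! f b \<longleftrightarrow> p ! a = p ! b)))"

definition avoids_pattern :: "nat list \<Rightarrow> nat list \<Rightarrow> bool" where
  "avoids_pattern w p \<longleftrightarrow> \<not> contains_pattern w p"

text \<open>The set counted here is finite, since every letter of a weak ascent sequence is bounded
  by the length of the word.\<close>

definition w021 :: "nat \<Rightarrow> nat" where
  "w021 n = card {w. length w = n \<and> weak_ascent_seq w \<and> avoids_pattern w [0, 2, 1]}"

text \<open>Complex coefficients, so that the series can be evaluated at complex points.\<close>

definition F021 :: "complex fps" where
  "F021 = Abs_fps (\<lambda>n. of_nat (w021 n))"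

text \<open>All functions are the principal complex branches. For real \<open>x > 0\<close> within the radius of
  convergence of \<open>F021\<close>, the radicand is positive and the argument of the inverse cosine lies in
  $[-1,1]$, so these are the usual real functions. For real \<open>x < 0\<close> near 0 that argument is
  below $-1$ and the real inverse cosine would be undefined.\<close>

definition v0 :: "complex \<Rightarrow> complex" where
  "v0 x =
     2 * csqrt (1 - 4 * x - 2 * x ^ 2) / (3 * x) *
       cos (- (1 / 3) *
              Arccos ((7 * x ^ 3 - 6 * x ^ 2 + 12 * x - 2) /
                      (2 * (1 - 4 * x - 2 * x ^ 2) powr (3 / 2)))
            + of_real pi / 3)
     + (x + 1) / (3 * x)"

end

theory Submission
  imports Defs
begin

text \<open>A weak ascent sequence avoids 021 iff its nonzero letters increase weakly, so its weak ascents
  are all adjacent pairs except a nonzero letter followed by 0.  Hence the number of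
  extensions of such a word depends only on whether it ends in 0 and on the gap between the largest
  admissible letter and the largest letter so far.  The resulting infinite linear system for the
  generating functions is solved by a geometric sequence in the gap, which gives the cubic
  equation for the series.

  The roots of this cubic correspond to those of \<open>x v\<^sup>3 - (x + 1) v\<^sup>2 + (x + 2) v - 1\<close> by
  \<open>F = v / (v - 1)\<close>, and the series belongs to the root \<open>v = (1 - x F\<^sup>2) / x\<close>.  Trisection writes
  the three roots \<open>v\<close> as \<open>(2 \<surd>D c + x + 1) / (3 x)\<close>, where \<open>D = 1 - 4 x - 2 x\<^sup>2\<close> and
  \<open>c\<close> runs through three cosines.  The principal branches in \<open>v0\<close> select the \<open>c\<close> of
  largest real part, so one has to show \<open>Re c > 0\<close> and \<open>Re c\<^sup>2 > 1/4\<close> for the root belonging to the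
  series, in the whole disc of convergence.\<close>

section \<open>Structure of weak ascent sequences avoiding 021\<close>

lemma wasc_snoc:
  assumes "w \<noteq> []"
  shows "wasc (w @ [a]) = wasc w + (if last w \<le> a then 1 else 0)"
proof -
  let ?S = "{j. Suc j < length w \<and> w ! j \<le> w ! Suc j}"
  have fin: "finite ?S" by (rule finite_subset[of _ "{..<length w}"]) auto
  obtain n where n: "length w = Suc n" using assms by (cases w) auto
  have "{j. Suc j < length (w @ [a]) \<and> (w @ [a]) ! j \<le> (w @ [a]) ! Suc j}
      = ?S \<union> (if last w \<le> a then {n} else {})"
    using assms n by (auto simp: nth_append last_conv_nth less_Suc_eq split: if_splits)
  then show ?thesis
    unfolding wasc_def using fin n by (auto simp: card_Un_disjoint)
qed

lemma weak_ascent_seq_snoc: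
  assumes "w \<noteq> []"
  shows "weak_ascent_seq (w @ [a]) \<longleftrightarrow> weak_ascent_seq w \<and> a \<le> wasc w + 1"
  using assms unfolding weak_ascent_seq_def
  by (auto simp: nth_append less_Suc_eq split: if_splits)

lemma contains_021_iff:
  "contains_pattern w [0, 2, 1] \<longleftrightarrow>
    (\<exists>i j k. i < j \<and> j < k \<and> k < length w \<and> w ! i < w ! k \<and> w ! k < w ! j)"
proof
  assume "contains_pattern w [0, 2, 1]"
  then obtain f where mono: "strict_mono_on {..<length [0, 2, 1 :: nat]} f"
    and len: "\<forall>a<length [0, 2, 1 :: nat]. f a < length w"
    and ord: "\<forall>a<length [0, 2, 1 :: nat]. \<forall>b<length [0, 2, 1 :: nat].
      (w ! f a < w ! f b \<longleftrightarrow> [0, 2, 1 :: nat] ! a < [0, 2, 1] ! b) \<and>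
      (w ! f a = w ! f b \<longleftrightarrow> [0, 2, 1 :: nat] ! a = [0, 2, 1] ! b)"
    unfolding contains_pattern_def by blast
  have "f 0 < f 1" "f 1 < f 2" using mono by (auto simp: strict_mono_on_def)
  moreover have "f 2 < length w" using len by simp
  moreover have "w ! f 0 < w ! f 2" using ord[rule_format, of 0 2] by simp
  moreover have "w ! f 2 < w ! f 1" using ord[rule_format, of 2 1] by simp
  ultimately show "\<exists>i j k. i < j \<and> j < k \<and> k < length w \<and> w ! i < w ! k \<and> w ! k < w ! j"
    by blast
next
  assume "\<exists>i j k. i < j \<and> j < k \<and> k < length w \<and> w ! i < w ! k \<and> w ! k < w ! j"
  then obtain i j k where ijk: "i < j" "j < k" "k < length w" "w ! i < w ! k" "w ! k < w ! j"
    by blast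
  have all3: "(\<forall>a<length [0, 2, 1 :: nat]. P a) \<longleftrightarrow> P 0 \<and> P 1 \<and> P 2" for P
    by (auto simp: less_Suc_eq numeral_2_eq_2)
  have "strict_mono_on {..<length [0, 2, 1 :: nat]} ((!) [i, j, k])"
    using ijk by (auto simp: strict_mono_on_def less_Suc_eq numeral_2_eq_2)
  then show "contains_pattern w [0, 2, 1]"
    unfolding contains_pattern_def all3 using ijk by (intro exI[of _ "(!) [i, j, k]"]) simp
qed

text \<open>The leading letter 0 can serve as the 0 of the pattern, so any strict drop to a nonzero
  letter already completes a 021.\<close>

lemma avoids_021_iff:
  assumes "weak_ascent_seq w"
  shows "avoids_pattern w [0, 2, 1] \<longleftrightarrow>
    (\<forall>i j. i < j \<and> j < length w \<and> w ! j \<noteq> 0 \<longrightarrow> w ! i \<le> w ! j)"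
proof -
  have "contains_pattern w [0, 2, 1] \<longleftrightarrow> (\<exists>i j. i < j \<and> j < length w \<and> w ! j \<noteq> 0 \<and> w ! j < w ! i)"
  proof
    assume "\<exists>i j. i < j \<and> j < length w \<and> w ! j \<noteq> 0 \<and> w ! j < w ! i"
    then obtain i j where ij: "i < j" "j < length w" "w ! j \<noteq> 0" "w ! j < w ! i" by blast
    then have w0: "w ! 0 = 0" using assms by (auto simp: weak_ascent_seq_def)
    then have "0 < i" using ij by (metis less_nat_zero_code neq0_conv)
    then show "contains_pattern w [0, 2, 1]"
      unfolding contains_021_iff using ij w0 by (metis neq0_conv)
  qed (metis contains_021_iff less_nat_zero_code)
  then show ?thesis
    unfolding avoids_pattern_def by (metis linorder_not_less)
qed

definition good021 :: "nat list \<Rightarrow> bool" where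
  "good021 w \<longleftrightarrow> weak_ascent_seq w \<and> avoids_pattern w [0, 2, 1]"

text \<open>The value 1 for all-zero words makes them obey the same extension recurrence as the other words
  ending in 0.\<close>

definition top_letter :: "nat list \<Rightarrow> nat" where
  "top_letter w = Max (insert 1 (set w))"

text \<open>On nonempty good words the truncated subtraction is exact by
  \<open>top_letter_le\<close>, and \<open>slack w + 1\<close> nonzero letters may follow
  \<open>w\<close>.\<close>

definition slack :: "nat list \<Rightarrow> nat" where
  "slack w = wasc w + 1 - top_letter w"

text \<open>A new occurrence of 021 must end in \<open>a\<close>: impossible for
  \<open>a = 0\<close>, and excluded for nonzero \<open>a\<close> exactly when no earlier letter
  exceeds it.\<close>

lemma good021_snoc:
  assumes "w \<noteq> []"
  shows "good021 (w @ [a]) \<longleftrightarrow>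
    good021 w \<and> (a = 0 \<or> top_letter w \<le> a \<and> a \<le> wasc w + 1)"
proof (cases "weak_ascent_seq (w @ [a])")
  case True
  then have w: "weak_ascent_seq w" "a \<le> wasc w + 1"
    using weak_ascent_seq_snoc[OF assms] by auto
  have "avoids_pattern (w @ [a]) [0, 2, 1] \<longleftrightarrow>
      avoids_pattern w [0, 2, 1] \<and> (a = 0 \<or> (\<forall>i<length w. w ! i \<le> a))"
    (is "?L \<longleftrightarrow> ?R")
  proof
    assume ?L
    then have L: "(w @ [a]) ! i \<le> (w @ [a]) ! j"
      if "i < j" "j < length (w @ [a])" "(w @ [a]) ! j \<noteq> 0" for i j
      using that unfolding avoids_021_iff[OF True] by blast
    show ?R
      unfolding avoids_021_iff[OF w(1)]
    proof (intro conjI allI impI)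
      fix i j assume "i < j \<and> j < length w \<and> w ! j \<noteq> 0"
      then show "w ! i \<le> w ! j" using L[of i j] by (simp add: nth_append)
    next
      show "a = 0 \<or> (\<forall>i<length w. w ! i \<le> a)"
        using L[of _ "length w"] by (auto simp: nth_append)
    qed
  next
    assume ?R
    then show ?L
      unfolding avoids_021_iff[OF True] avoids_021_iff[OF w(1)]
      by (auto simp: nth_append less_Suc_eq)
  qed
  moreover have "(\<forall>i<length w. w ! i \<le> a) \<longleftrightarrow> (\<forall>b\<in>set w. b \<le> a)"
    by (metis in_set_conv_nth)
  ultimately show ?thesis
    using w True by (auto simp: good021_def top_letter_def)
next
  case False
  then have "\<not> (weak_ascent_seq w \<and> a \<le> wasc w + 1)"
    using weak_ascent_seq_snoc[OF assms] by auto
  then show ?thesis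
    using False by (auto simp: good021_def)
qed

lemma good021_single: "good021 [a] \<longleftrightarrow> a = 0"
proof -
  have "weak_ascent_seq [a] \<longleftrightarrow> a = 0" by (simp add: weak_ascent_seq_def)
  then show ?thesis using avoids_021_iff[of "[a]"] by (auto simp: good021_def)
qed

lemma good021_prefix: "good021 (w @ u) \<Longrightarrow> w \<noteq> [] \<Longrightarrow> good021 w"
proof (induction u rule: rev_induct)
  case (snoc a u)
  then show ?case using good021_snoc[of "w @ u" a] by simp
qed simp

lemma top_letter_snoc: "top_letter (w @ [a]) = max (top_letter w) a"
  by (simp add: top_letter_def insert_commute max.commute)

lemma top_letter_le:
  assumes "good021 w" "w \<noteq> []"
  shows "top_letter w \<le> wasc w + 1"
  using assms
proof (induction w rule: rev_induct)
  case (snoc a w)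
  show ?case
  proof (cases "w = []")
    case True
    then show ?thesis using snoc.prems by (simp add: top_letter_def good021_single)
  next
    case False
    then show ?thesis
      using snoc.prems snoc.IH by (auto simp: top_letter_snoc good021_snoc wasc_snoc)
  qed
qed simp

section \<open>Counting extensions by last letter and slack\<close>

text \<open>Numbers of good extensions by \<open>n\<close> letters of a word with slack
  \<open>h\<close> ending in 0 (\<open>zext\<close>) or in a nonzero letter (\<open>nzext\<close>).
  Appending 0 raises the slack only after a 0; \<open>j\<close> is the slack left by a nonzero
  letter.\<close>

fun zext nzext :: "nat \<Rightarrow> nat \<Rightarrow> nat" where
  "zext 0 h = 1"
| "zext (Suc n) h = zext n (Suc h) + (\<Sum>j=1..Suc h. nzext n j)"
| "nzext 0 h = 1"
| "nzext (Suc n) h = zext n h + (\<Sum>j=1..Suc h. nzext n j)"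

lemma card_extensions:
  assumes "good021 w" "w \<noteq> []"
  shows "finite {u. length u = n \<and> good021 (w @ u)} \<and>
    card {u. length u = n \<and> good021 (w @ u)} =
      (if last w = 0 then zext n (slack w) else nzext n (slack w))"
  using assms
proof (induction n arbitrary: w)
  case 0
  then have "{u. length u = 0 \<and> good021 (w @ u)} = {[]}" by auto
  then show ?case by simp
next
  case (Suc n)
  define A where "A = {top_letter w..wasc w + 1}"
  define E where "E a = {u. length u = n \<and> good021 ((w @ [a]) @ u)}" for a
  define N where "N a = card (E a)" for a
  have good_ext: "good021 (w @ [a]) \<longleftrightarrow> a \<in> insert 0 A" for a
    using Suc.prems by (auto simp: good021_snoc A_def)
  have IH: "finite (E a) \<and> N a =
      (if a = 0 then zext n (slack (w @ [a])) else nzext n (slack (w @ [a])))"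
    if "a \<in> insert 0 A" for a
    using Suc.IH[of "w @ [a]"] good_ext[of a] that unfolding E_def N_def by auto
  have top: "top_letter w \<le> wasc w + 1" "1 \<le> top_letter w"
    using top_letter_le[OF Suc.prems] by (auto simp: top_letter_def)
  then have A: "finite A" "0 \<notin> A" by (auto simp: A_def)
  have last_le: "last w \<le> top_letter w"
    unfolding top_letter_def using Suc.prems by (intro Max_ge) auto
  have split: "{u. length u = Suc n \<and> good021 (w @ u)} = (\<Union>a\<in>insert 0 A. (#) a ` E a)" (is "?L = ?R")
  proof (intro set_eqI iffI)
    fix u assume "u \<in> ?L"
    then obtain a v where u: "u = a # v" "length v = n" "good021 ((w @ [a]) @ v)"
      by (cases u) auto
    then have "a \<in> insert 0 A" using good021_prefix[OF u(3)] good_ext by simp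
    then show "u \<in> ?R" using u by (auto simp: E_def)
  qed (auto simp: E_def)
  have fin: "finite {u. length u = Suc n \<and> good021 (w @ u)}"
    unfolding split using A IH by blast
  have "card {u. length u = Suc n \<and> good021 (w @ u)} = (\<Sum>a\<in>insert 0 A. card ((#) a ` E a))"
    unfolding split using A IH by (intro card_UN_disjoint) auto
  also have "\<dots> = (\<Sum>a\<in>insert 0 A. N a)"
    by (simp add: N_def card_image)
  also have "\<dots> = N 0 + (\<Sum>a\<in>A. N a)"
    using A by simp
  also have "(\<Sum>a\<in>A. N a) = (\<Sum>j=1..Suc (slack w). nzext n j)"
  \<comment> \<open>An admissible nonzero \<open>a\<close> creates a weak ascent and becomes the top
    letter, so \<open>wasc w + 2 - a\<close> is the slack of \<open>w @ [a]\<close>.\<close>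
  proof (rule sum.reindex_bij_witness[of _ "\<lambda>j. wasc w + 2 - j" "\<lambda>a. wasc w + 2 - a"])
    fix a assume a: "a \<in> A"
    then have "a \<noteq> 0" using A by metis
    then show "nzext n (wasc w + 2 - a) = N a"
      using a IH[of a] Suc.prems last_le
      by (auto simp: A_def slack_def wasc_snoc top_letter_snoc max_def)
  qed (use top in \<open>auto simp: A_def slack_def\<close>)
  also have "N 0 = (if last w = 0 then zext n (Suc (slack w)) else zext n (slack w))"
    using IH[of 0] Suc.prems top
    by (auto simp: slack_def wasc_snoc top_letter_snoc Suc_diff_le)
  finally show ?case using fin by simp
qed

lemma w021_0: "w021 0 = 1"
proof -
  have "{w. length w = 0 \<and> weak_ascent_seq w \<and> avoids_pattern w [0, 2, 1]} = {[]}"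
    by (auto simp: weak_ascent_seq_def avoids_pattern_def contains_pattern_def)
  then show ?thesis by (simp add: w021_def)
qed

lemma w021_Suc: "w021 (Suc n) = zext n 0"
proof -
  \<comment> \<open>The convention \<open>top_letter [0] = 1\<close> cancels the \<open>+ 1\<close>
    in the slack.\<close>
  have slack0: "slack [0] = 0" by (simp add: slack_def wasc_def top_letter_def)
  have "{w. length w = Suc n \<and> good021 w} = (#) 0 ` {u. length u = n \<and> good021 ([0] @ u)}" (is "?L = ?R")
  proof (intro set_eqI iffI)
    fix w assume "w \<in> ?L"
    then obtain a u where w: "w = a # u" "length u = n" "good021 ([a] @ u)" by (cases w) auto
    then show "w \<in> ?R" using good021_prefix[OF w(3)] good021_single[of a] by auto
  qed auto
  then have "w021 (Suc n) = card {u. length u = n \<and> good021 ([0] @ u)}"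
    unfolding w021_def good021_def[symmetric] by (simp add: card_image)
  also have "\<dots> = zext n 0"
    using card_extensions[of "[0]" n] by (simp add: good021_single slack0)
  finally show ?thesis .
qed

section \<open>Solving the system by formal power series\<close>

text \<open>With \<open>F = 1 + G\<close> the equation reads
  \<open>G = X (1 + G) (1 + G + G^2)\<close>, so \<open>G\<close> is the compositional inverse of
  \<open>X / B\<close>. The series so constructed is identified with \<open>F021\<close> only
  afterwards.\<close>

lemma fps_functional_equation_solution:
  obtains F :: "complex fps" where "fps_nth F 0 = 1" "F - 1 = fps_X * F + fps_X * F\<^sup>2 * (F - 1)"
proof -
  define B :: "complex fps" where "B = (1 + fps_X) * (1 + fps_X + fps_X\<^sup>2)"
  define A where "A = fps_X * inverse B"
  define G where "G = fps_inv A"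
  have B0: "fps_nth B 0 = 1" by (simp add: B_def)
  have A0: "fps_nth A 0 = 0" and A1: "fps_nth A 1 \<noteq> 0"
    using B0 by (simp_all add: A_def)
  have G0: "fps_nth G 0 = 0" by (simp add: G_def fps_inv_def)
  have BG: "B oo G = (1 + G) * (1 + G + G\<^sup>2)"
    by (simp add: B_def fps_compose_mult_distrib G0 fps_compose_add_distrib power2_eq_square)
  have "A * B = fps_X"
    using B0 by (simp add: A_def mult.assoc inverse_mult_eq_1)
  then have "fps_X oo G = (A oo G) * (B oo G)"
    using fps_compose_mult_distrib[OF G0, of A B] by simp
  then have "G = fps_X * ((1 + G) * (1 + G + G\<^sup>2))"
    using fps_inv_right[OF A0 A1] by (simp add: G0 BG flip: G_def)
  then have "(1 + G) - 1 = fps_X * (1 + G) + fps_X * (1 + G)\<^sup>2 * ((1 + G) - 1)"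
    by (simp add: algebra_simps power2_eq_square)
  moreover have "fps_nth (1 + G) 0 = 1" using G0 by simp
  ultimately show ?thesis using that by blast
qed

text \<open>Makes coefficient \<open>n + 1\<close> of \<open>F\<close> equal to coefficient
  \<open>n\<close> of \<open>F * L\<close>, matching the shift in \<open>w021_Suc\<close>.\<close>

lemma fps_geometric_form:
  fixes F L :: "complex fps"
  assumes F: "F - 1 = fps_X * F + fps_X * F\<^sup>2 * (F - 1)"
    and L: "L * (1 - fps_X * F\<^sup>2) = 1"
  shows "F = 1 + fps_X * (F * L)"
proof -
  have "(F - 1) * (1 - fps_X * F\<^sup>2) = fps_X * F"
    using F by (simp add: algebra_simps)
  then have "(F - 1) * (L * (1 - fps_X * F\<^sup>2)) = fps_X * (F * L)"
    by (metis mult.assoc mult.commute)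
  then show ?thesis
    unfolding L by (simp add: algebra_simps)
qed

text \<open>Writing \<open>P\<^sub>h\<close> and \<open>Q\<^sub>h\<close> for the generating functions of \<open>zext\<close> and \<open>nzext\<close> at slack \<open>h\<close>, the
  recurrences say \<open>P\<^sub>h - Q\<^sub>h = x (P\<^sub>h\<^sub>+\<^sub>1 - P\<^sub>h)\<close> together with a linear recurrence for \<open>P\<^sub>h\<close>
  with constant coefficients in \<open>h\<close>.  The ansatz of a geometric sequence \<open>P\<^sub>h = F L\<^sup>h\<^sup>+\<^sup>1\<close>
  leads to \<open>L = 1 / (1 - x F\<^sup>2)\<close>.\<close>

lemma zext_nzext_fps:
  fixes F L :: "complex fps"
  assumes F: "F - 1 = fps_X * F + fps_X * F\<^sup>2 * (F - 1)"
    and L: "L * (1 - fps_X * F\<^sup>2) = 1"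
  shows "of_nat (zext n h) = fps_nth (F * L ^ Suc h) n \<and>
    of_nat (nzext n h) = fps_nth (F * L ^ Suc h * (1 - fps_X * (L - 1))) n"
proof -
  let ?X = "fps_X :: complex fps"
  define P where "P h = F * L ^ Suc h" for h
  define Q where "Q h = P h * (1 - ?X * (L - 1))" for h
  have FL: "F - 1 = ?X * F * L"
    by (subst fps_geometric_form[OF F L]) (simp add: mult.assoc)
  have LF: "L - 1 = ?X * F\<^sup>2 * L"
    using L by (simp add: algebra_simps)
  have FX: "F * (1 - ?X * L) = 1"
    using FL by (simp add: algebra_simps)
  \<comment> \<open>\<open>F = 1 / (1 - X L)\<close> eliminates \<open>F\<close> and leaves an
    equation in \<open>L\<close> alone.\<close>
  have cubic: "(L - 1) * (1 - ?X * L)\<^sup>2 = ?X * L"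
  proof -
    have "(L - 1) * (1 - ?X * L)\<^sup>2 = ?X * L * (F * (1 - ?X * L))\<^sup>2"
      by (subst LF) (simp add: power_mult_distrib mult_ac)
    then show ?thesis by (simp add: FX)
  qed
  \<comment> \<open>Characteristic equation of the recurrence \<open>PQ\<close> differenced in
    \<open>h\<close>.\<close>
  have L2: "L - 1 = ?X * L * (L - 1) + ?X * L\<^sup>2 - ?X\<^sup>2 * L\<^sup>2 * (L - 1)"
  proof -
    have "(L - 1) * (1 - ?X * L + ?X\<^sup>2 * L\<^sup>2) = (L - 1) * (1 - ?X * L)\<^sup>2 + ?X * L * (L - 1)"
      by (simp add: algebra_simps power2_eq_square)
    then show ?thesis using cubic by (simp add: algebra_simps power2_eq_square)
  qed
  \<comment> \<open>Initial condition: \<open>PQ\<close> at \<open>h = 0\<close>.\<close>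
  have b: "F * L = 1 + ?X * F * L\<^sup>2 + ?X * F * L\<^sup>2 * (1 - ?X * (L - 1))"
  proof -
    have "L = (1 - ?X * L) + ?X * L\<^sup>2 + ?X * L\<^sup>2 * (1 - ?X * (L - 1))"
      using cubic by (simp add: algebra_simps power2_eq_square)
    then have "F * L = F * ((1 - ?X * L) + ?X * L\<^sup>2 + ?X * L\<^sup>2 * (1 - ?X * (L - 1)))"
      by simp
    also have "\<dots> = F * (1 - ?X * L) + ?X * F * L\<^sup>2 + ?X * F * L\<^sup>2 * (1 - ?X * (L - 1))"
      by (simp add: algebra_simps)
    finally show ?thesis using FX by simp
  qed
  have PQ: "P h = 1 + ?X * P (Suc h) + ?X * (\<Sum>j=1..Suc h. Q j)" for h
  proof (induction h)
    case 0
    then show ?case using b by (simp add: P_def Q_def power2_eq_square mult.assoc)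
  next
    case (Suc h)
    have "P (Suc h) - P h = ?X * P (Suc (Suc h)) - ?X * P (Suc h) + ?X * Q (Suc (Suc h))"
    proof -
      have "P (Suc h) - P h = P h * (L - 1)"
        by (simp add: P_def algebra_simps)
      also have "\<dots> = P h * (?X * L * (L - 1) + ?X * L\<^sup>2 - ?X\<^sup>2 * L\<^sup>2 * (L - 1))"
        using L2 by simp
      also have "\<dots> = ?X * P (Suc (Suc h)) - ?X * P (Suc h) + ?X * Q (Suc (Suc h))"
        by (simp add: P_def Q_def algebra_simps power2_eq_square)
      finally show ?thesis .
    qed
    then show ?case using Suc.IH by (simp add: algebra_simps)
  qed
  have QP: "Q h = 1 + ?X * P h + ?X * (\<Sum>j=1..Suc h. Q j)" for h
  proof -
    have "Q h = P h - ?X * (P (Suc h) - P h)"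
      by (simp add: P_def Q_def algebra_simps)
    also have "\<dots> = 1 + ?X * P h + ?X * (\<Sum>j=1..Suc h. Q j)"
      by (subst PQ[of h]) (simp add: algebra_simps)
    finally show ?thesis .
  qed
  \<comment> \<open>Each series on the right of \<open>PQ\<close> and \<open>QP\<close> carries a
    factor \<open>X\<close>, so coefficient \<open>n + 1\<close> is determined by the coefficients
    at \<open>n\<close>.\<close>
  have "of_nat (zext n h) = fps_nth (P h) n \<and> of_nat (nzext n h) = fps_nth (Q h) n"
  proof (induction n arbitrary: h)
    case 0
    show ?case by (subst PQ, subst QP) simp
  next
    case (Suc n)
    show ?case
      by (subst PQ, subst QP) (simp add: Suc.IH fps_sum_nth)
  qed
  then show ?thesis by (simp add: P_def Q_def)
qed

text \<open>The constructed solution has constant term 1 and, by the extension count at slack 0, the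
  same further coefficients as \<open>F021\<close>.\<close>

lemma F021_functional_equation:
  "F021 - 1 = fps_X * F021 + fps_X * F021\<^sup>2 * (F021 - 1)"
proof -
  obtain F :: "complex fps" where F: "fps_nth F 0 = 1" "F - 1 = fps_X * F + fps_X * F\<^sup>2 * (F - 1)"
    using fps_functional_equation_solution .
  define L where "L = inverse (1 - fps_X * F\<^sup>2)"
  have L: "L * (1 - fps_X * F\<^sup>2) = 1"
    unfolding L_def by (rule inverse_mult_eq_1) simp
  have FL: "F = 1 + fps_X * (F * L)"
    by (rule fps_geometric_form[OF F(2) L])
  have "fps_nth F021 n = fps_nth F n" for n
  proof (cases n)
    case 0
    then show ?thesis using F(1) by (simp add: F021_def w021_0)
  next
    case (Suc m)
    have "fps_nth F (Suc m) = fps_nth (F * L) m"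
      by (subst FL) simp
    then show ?thesis
      using zext_nzext_fps[OF F(2) L, of m 0] Suc by (simp add: F021_def w021_Suc)
  qed
  then have "F021 = F" by (simp add: fps_eq_iff)
  then show ?thesis using F by simp
qed

section \<open>Trisection of the cubic on principal branches\<close>

text \<open>For \<open>c = cos t\<close> the argument is
  \<open>- cos (3 t) = cos (pi - 3 t)\<close>. The hypotheses force \<open>0 <= Re t < pi/3\<close>,
  so \<open>pi - 3 t\<close> is the principal value.\<close>

lemma cos_Arccos_trisection:
  fixes c :: complex
  assumes c2: "Re (c\<^sup>2) > 1/4" and c: "Re c > 0"
  shows "cos ((of_real pi - Arccos (3 * c - 4 * c ^ 3)) / 3) = c"
proof -
  \<comment> \<open>At \<open>Re t = 0\<close> the point \<open>pi - 3 t\<close> lies on the edge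
    \<open>Re = pi\<close> of the principal range, which requires \<open>Im t >= 0\<close>; evenness
    of cosine permits this sign.\<close>
  obtain t where t: "cos t = c" "0 \<le> Re t" "Re t \<le> pi" "Re t = 0 \<Longrightarrow> 0 \<le> Im t"
  proof (cases "Re (Arccos c) < 0 \<or> Re (Arccos c) = 0 \<and> Im (Arccos c) < 0")
    case True
    then show ?thesis using that[of "- Arccos c"] Re_Arccos_bounds[of c] by auto
  next
    case False
    then show ?thesis using that[of "Arccos c"] Re_Arccos_bounds[of c] by auto
  qed
  define a b where "a = Re t" and "b = Im t"
  \<comment> \<open>\<open>C\<close> is cosh \<open>b\<close> and \<open>H\<close> is minus sinh
    \<open>b\<close>.\<close>
  define C H where "C = (exp b + exp (- b)) / 2" and "H = (exp (- b) - exp b) / 2"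
  have C2: "C\<^sup>2 = 1 + H\<^sup>2"
    by (simp add: C_def H_def power2_eq_square field_simps flip: exp_add)
  have Re_c: "Re c = cos a * C"
    using Re_cos[of t] t(1) by (simp add: a_def b_def C_def)
  have Im_c: "Im c = sin a * H"
    using Im_cos[of t] t(1) by (simp add: a_def b_def H_def)
  have "C > 0" by (simp add: C_def add_pos_pos)
  have cos_pos: "cos a > 0"
    using c \<open>C > 0\<close> unfolding Re_c by (simp add: zero_less_mult_iff)
  have "a < pi / 3"
  proof (rule ccontr)
    assume "\<not> a < pi / 3"
    then have "cos a \<le> cos (pi / 3)"
      using t by (intro cos_monotone_0_pi_le) (auto simp: a_def)
    then have ca: "(cos a)\<^sup>2 \<le> 1/4"
      using cos_pos power_mono[of "cos a" "1/2" 2] by (simp add: cos_60 power2_eq_square)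
    have "Re (c\<^sup>2) = (cos a)\<^sup>2 * (1 + H\<^sup>2) - (1 - (cos a)\<^sup>2) * H\<^sup>2"
      by (simp add: Re_power2 Re_c Im_c power_mult_distrib C2 sin_squared_eq)
    also have "\<dots> = (cos a)\<^sup>2 + (2 * (cos a)\<^sup>2 - 1) * H\<^sup>2"
      by (simp add: algebra_simps)
    also have "\<dots> \<le> 1/4 + 0"
      using ca by (intro add_mono mult_nonpos_nonneg) auto
    finally show False using c2 by simp
  qed
  have "cos (of_real pi - 3 * t) = 3 * c - 4 * c ^ 3"
    using cos_treble_cos[of t] t(1) by (simp add: cos_diff)
  then have "Arccos (3 * c - 4 * c ^ 3) = of_real pi - 3 * t"
    using \<open>a < pi / 3\<close> t by (intro Arccos_unique) (auto simp: a_def)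
  then show ?thesis using t(1) by simp
qed

text \<open>The root \<open>v = (1 - x f^2) / x\<close> equals \<open>(p + x + 1) / (3 x)\<close>
  with \<open>p = 2 - x - 3 x f^2\<close>, and the cubic makes \<open>c = p / (2 s)\<close> a
  trisecting cosine.\<close>

lemma v0_eq:
  fixes x f :: complex
  assumes x: "x \<noteq> 0"
    and cubic: "x * f ^ 3 - x * f\<^sup>2 + (x - 1) * f + 1 = 0"
    and D: "Re (1 - 4 * x - 2 * x\<^sup>2) > 0"
    and q: "Re (2 - x - 3 * x * f\<^sup>2) > 0"
    and c2: "Re ((2 - x - 3 * x * f\<^sup>2)\<^sup>2 / (4 * (1 - 4 * x - 2 * x\<^sup>2))) > 1/4"
  shows "v0 x = (1 - x * f\<^sup>2) / x"
proof -
  define D' where "D' = 1 - 4 * x - 2 * x\<^sup>2"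
  define s where "s = csqrt D'"
  define p where "p = 2 - x - 3 * x * f\<^sup>2"
  define c where "c = p / (2 * s)"
  have "Re D' > 0" using D by (simp only: D'_def)
  then have D'0: "D' \<noteq> 0" by auto
  then have s0: "s \<noteq> 0" by (simp add: s_def)
  have s2: "s\<^sup>2 = D'" by (simp add: s_def)
  have p: "p = 2 * s * c" using s0 by (simp add: c_def)
  have powr: "D' powr (3 / 2) = s ^ 3"
    using D'0 by (simp add: s_def csqrt_exp_Ln powr_def flip: exp_of_nat_mult)
  have Re_c2: "Re (c\<^sup>2) > 1/4"
    using c2 by (simp add: c_def p_def D'_def power_divide power_mult_distrib s2[unfolded D'_def])
  \<comment> \<open>Both \<open>s\<close> and \<open>c\<close> lie in the double cone where the real
    part dominates, and \<open>s\<close> in its right half. With \<open>c\<close> in the left half,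
    \<open>Re (s * c)\<close> could not be positive, unlike \<open>Re p\<close>.\<close>
  have "Re c > 0"
  proof (rule ccontr)
    assume neg: "\<not> Re c > 0"
    have "(Im c)\<^sup>2 < (Re c)\<^sup>2" using Re_c2 by (simp add: Re_power2)
    then have 1: "\<bar>Im c\<bar> < - Re c" using neg by (metis abs_of_nonpos not_less power2_less_imp_less abs_ge_zero power2_abs)
    have "(Im s)\<^sup>2 < (Re s)\<^sup>2" using D s2 Re_power2[of s] by (simp add: D'_def)
    moreover have "Re s \<ge> 0" unfolding s_def using csqrt_principal[of D'] by auto
    ultimately have 2: "\<bar>Im s\<bar> \<le> Re s" by (metis abs_of_nonneg abs_le_square_iff less_imp_le)
    have "\<bar>Im s * Im c\<bar> \<le> Re s * (- Re c)"
      unfolding abs_mult using 1 2 by (intro mult_mono) auto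
    then have "Re (s * c) \<le> 0" by simp
    then show False using q unfolding p_def[symmetric] p by simp
  qed
  have "7 * x ^ 3 - 6 * x\<^sup>2 + 12 * x - 2 = 3 * p * s\<^sup>2 - p ^ 3"
  proof -
    \<comment> \<open>The left side is even in \<open>f\<close>, so the cubic appears together with
      its mirror image under \<open>f -> -f\<close>.\<close>
    have "3 * p * s\<^sup>2 - p ^ 3 - (7 * x ^ 3 - 6 * x\<^sup>2 + 12 * x - 2)
       = 27 * x * (x * f ^ 3 + x * f\<^sup>2 + (x - 1) * f - 1) * (x * f ^ 3 - x * f\<^sup>2 + (x - 1) * f + 1)"
      unfolding s2 D'_def p_def by algebra
    then show ?thesis using cubic by simp
  qed
  then have "(7 * x ^ 3 - 6 * x\<^sup>2 + 12 * x - 2) / (2 * s ^ 3) = 3 * c - 4 * c ^ 3"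
    using s0 by (simp add: p field_simps power2_eq_square power3_eq_cube)
  then have "cos (- (1 / 3) * Arccos ((7 * x ^ 3 - 6 * x ^ 2 + 12 * x - 2) /
      (2 * (1 - 4 * x - 2 * x ^ 2) powr (3 / 2))) + of_real pi / 3) = c"
    using cos_Arccos_trisection[OF Re_c2 \<open>Re c > 0\<close>] powr
    by (simp add: D'_def diff_divide_distrib)
  then have "v0 x = 2 * s / (3 * x) * c + (x + 1) / (3 * x)"
    by (simp add: v0_def s_def D'_def)
  also have "\<dots> = (p + x + 1) / (3 * x)"
    using x by (simp add: p add_divide_distrib add.assoc)
  also have "\<dots> = (1 - x * f\<^sup>2) / x"
    using x by (simp add: p_def field_simps)
  finally show ?thesis .
qed

text \<open>After clearing denominators the claim is polynomial in \<open>x v = 1 - x f^2\<close>,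
  and the difference of its sides is a multiple of the cubic.\<close>

lemma kernel_root_to_series:
  fixes x f :: complex
  assumes x: "x \<noteq> 0"
    and cubic: "x * f ^ 3 - x * f\<^sup>2 + (x - 1) * f + 1 = 0"
    and v: "v = (1 - x * f\<^sup>2) / x"
  shows "f - 1 = - ((x * v\<^sup>2 - v + x + 1) / x)"
proof -
  have xv: "x * v = 1 - x * f\<^sup>2" using x by (simp add: v)
  have "x * (x * (f - 1) + (x * v\<^sup>2 - v + x + 1)) = x\<^sup>2 * f + (x * v)\<^sup>2 - x * v + x"
    by algebra
  also have "\<dots> = x * (f + 1) * (x * f ^ 3 - x * f\<^sup>2 + (x - 1) * f + 1)"
    unfolding xv by algebra
  finally have "x * (f - 1) + (x * v\<^sup>2 - v + x + 1) = 0"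
    using x cubic by simp
  then show ?thesis using x by (simp add: field_simps add_eq_0_iff)
qed

section \<open>Estimates selecting the branch\<close>

text \<open>The left side has mixed signs. On the right only \<open>f\<close>, \<open>f - 1\<close>
  and \<open>1 / (1 - x f^2)\<close> occur, with plus signs, so norms can be bounded factor by
  factor.\<close>

lemma kernel_discriminant:
  fixes x f :: "'a :: field"
  assumes cubic: "x * f ^ 3 - x * f\<^sup>2 + (x - 1) * f + 1 = 0"
    and u: "1 - x * f\<^sup>2 \<noteq> 0"
  shows "4 * (1 - 4 * x - 2 * x\<^sup>2) - (2 - x - 3 * x * f\<^sup>2)\<^sup>2
    = 3 * (x ^ 4 * f\<^sup>2 * (f - 1)\<^sup>2 + 4 * x ^ 3 * f) / (1 - x * f\<^sup>2)\<^sup>2"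
proof -
  have "(4 * (1 - 4 * x - 2 * x\<^sup>2) - (2 - x - 3 * x * f\<^sup>2)\<^sup>2) * (1 - x * f\<^sup>2)\<^sup>2
      - 3 * (x ^ 4 * f\<^sup>2 * (f - 1)\<^sup>2 + 4 * x ^ 3 * f)
    = (- 12 * x - 9 * x\<^sup>2 + (3 * x\<^sup>2 - 12 * x - 3 * x ^ 3) * f + (21 * x\<^sup>2 + 3 * x ^ 3) * f\<^sup>2
        + (21 * x\<^sup>2 - 6 * x ^ 3) * f ^ 3 - 9 * x ^ 3 * f ^ 4 - 9 * x ^ 3 * f ^ 5)
      * (x * f ^ 3 - x * f\<^sup>2 + (x - 1) * f + 1)"
    by algebra
  then show ?thesis using cubic u by (simp add: eq_divide_eq)
qed

text \<open>Here \<open>g\<close> and \<open>g'\<close> are the values of the series and of its derivative at \<open>r = |x|\<close>.  With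
  \<open>p = 2 - x - 3 x f\<^sup>2\<close> and \<open>D = 1 - 4 x - 2 x\<^sup>2\<close>, the cubic gives an expression for \<open>4 D - p\<^sup>2\<close> that has
  nonnegative Taylor coefficients, so \<open>|4 D - p\<^sup>2| / |4 D|\<close> is largest on the positive axis; there
  it is below \<open>3/4\<close> because \<open>p\<^sup>2 - D\<close> is a positive multiple of the partial derivative of the cubic
  in \<open>f\<close>, which cannot vanish as long as the series has a finite derivative.\<close>

lemma v0_series_bounds:
  fixes x f :: complex and g g' :: real
  defines "r \<equiv> norm x"
  assumes x: "x \<noteq> 0"
    and cubic: "x * f ^ 3 - x * f\<^sup>2 + (x - 1) * f + 1 = 0"
    and cubic_r: "r * g ^ 3 - r * g\<^sup>2 + (r - 1) * g + 1 = 0"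
    and deriv: "g' * (1 - r + 2 * r * g - 3 * r * g\<^sup>2) = g ^ 3 - g\<^sup>2 + g"
    and g': "g' \<ge> 0" and g: "g \<ge> 1"
    and f: "norm f \<le> g" "norm (f - 1) \<le> g - 1"
  shows "Re (1 - 4 * x - 2 * x\<^sup>2) > 0"
    and "Re (2 - x - 3 * x * f\<^sup>2) > 0"
    and "Re ((2 - x - 3 * x * f\<^sup>2)\<^sup>2 / (4 * (1 - 4 * x - 2 * x\<^sup>2))) > 1/4"
proof -
  have r: "r > 0" using x by (simp add: r_def)
  have "g \<noteq> 1" using cubic_r r by auto
  with g have g1: "g > 1" by simp
  \<comment> \<open>Minus the partial derivative of the cubic in \<open>g\<close>;
    \<open>deriv\<close> makes \<open>g' * E\<close> positive.\<close>
  define E where "E = 1 - r + 2 * r * g - 3 * r * g\<^sup>2"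
  have "g ^ 3 - g\<^sup>2 + g = g * ((g - 1)\<^sup>2 + g)" by algebra
  then have "g' * E > 0"
    unfolding E_def deriv using g1 by (simp add: zero_less_mult_iff add_nonneg_pos)
  then have E: "E > 0" using g' by (simp add: zero_less_mult_iff)
  have "(g - 1) * (1 - r * g\<^sup>2) = r * g" using cubic_r by algebra
  then have "(g - 1) * (1 - r * g\<^sup>2) > 0" using r g1 by simp
  then have u: "1 - r * g\<^sup>2 > 0" using g1 by (simp add: zero_less_mult_iff)
  define p where "p = 2 - r - 3 * r * g\<^sup>2"
  define D where "D = 1 - 4 * r - 2 * r\<^sup>2"
  define K where "K = 3 * (r ^ 4 * g\<^sup>2 * (g - 1)\<^sup>2 + 4 * r ^ 3 * g) / (1 - r * g\<^sup>2)\<^sup>2"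
  have pD: "g * (p\<^sup>2 - D) = 3 * E * (1 - r * g\<^sup>2)"
  proof -
    have "g * (p\<^sup>2 - D) - 3 * E * (1 - r * g\<^sup>2)
        = (9 * r * g\<^sup>2 + 3 * (r - 1)) * (r * g ^ 3 - r * g\<^sup>2 + (r - 1) * g + 1)"
      unfolding p_def D_def E_def by algebra
    then show ?thesis using cubic_r by simp
  qed
  have K: "4 * D - p\<^sup>2 = K"
    unfolding D_def p_def K_def using u by (intro kernel_discriminant cubic_r) simp
  have pD_pos: "p\<^sup>2 - D > 0"
  proof -
    have "g * (p\<^sup>2 - D) > 0" using pD E u by simp
    then show ?thesis using g1 by (simp add: zero_less_mult_iff)
  qed
  have "K > 0" unfolding K_def using r g1 u by (intro divide_pos_pos mult_pos_pos add_nonneg_pos) auto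
  then have D: "D > 0" using K pD_pos zero_le_power2[of p] by linarith
  have p: "p > 0"
  proof -
    \<comment> \<open>Suffices because \<open>p = E + 1 - 2 * r * g\<close>.\<close>
    have "2 * r * g \<le> 1"
    proof (rule ccontr)
      assume "\<not> 2 * r * g \<le> 1"
      then have "r * (3 * g\<^sup>2 - 2 * g + 1) < 2 * r * g" using E by (simp add: E_def algebra_simps)
      then have "r * ((3 * g - 1) * (g - 1)) < 0" by (simp add: algebra_simps power2_eq_square)
      moreover have "r * ((3 * g - 1) * (g - 1)) > 0" using r g1 by simp
      ultimately show False by simp
    qed
    then show ?thesis using E by (simp add: E_def p_def)
  qed
  have f2: "norm (x * f\<^sup>2) \<le> r * g\<^sup>2"
    unfolding norm_mult norm_power r_def using f(1) by (intro mult_left_mono power_mono) auto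
  define D' where "D' = 1 - 4 * x - 2 * x\<^sup>2"
  define p' where "p' = 2 - x - 3 * x * f\<^sup>2"
  have "norm (4 * x + 2 * x\<^sup>2) \<le> 4 * r + 2 * r\<^sup>2"
    by (rule order_trans[OF norm_triangle_ineq]) (simp add: norm_mult norm_power r_def)
  then have D'_re: "D \<le> Re D'"
    using complex_Re_le_cmod[of "4 * x + 2 * x\<^sup>2"] by (simp add: D_def D'_def)
  then show "Re (1 - 4 * x - 2 * x\<^sup>2) > 0" using D by (simp add: D'_def)
  have D'_norm: "D \<le> norm D'" using D'_re complex_Re_le_cmod[of D'] by linarith
  have "norm (x + 3 * (x * f\<^sup>2)) \<le> r + 3 * (r * g\<^sup>2)"
    using f2 by (intro order_trans[OF norm_triangle_ineq]) (auto simp: norm_mult r_def)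
  then show "Re (2 - x - 3 * x * f\<^sup>2) > 0"
    using complex_Re_le_cmod[of "x + 3 * (x * f\<^sup>2)"] p by (simp add: p_def mult.assoc)
  have u': "1 - r * g\<^sup>2 \<le> norm (1 - x * f\<^sup>2)"
    using f2 norm_triangle_ineq2[of 1 "x * f\<^sup>2"] by simp
  have K': "4 * D' - p'\<^sup>2 = 3 * (x ^ 4 * f\<^sup>2 * (f - 1)\<^sup>2 + 4 * x ^ 3 * f) / (1 - x * f\<^sup>2)\<^sup>2"
    unfolding D'_def p'_def using u u' by (intro kernel_discriminant cubic) auto
  have "norm (4 * D' - p'\<^sup>2) \<le> K"
    unfolding K' K_def norm_divide norm_power
  proof (intro frac_le power_mono u')
    show "norm (3 * (x ^ 4 * f\<^sup>2 * (f - 1)\<^sup>2 + 4 * x ^ 3 * f)) \<le> 3 * (r ^ 4 * g\<^sup>2 * (g - 1)\<^sup>2 + 4 * r ^ 3 * g)"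
    proof -
      have "norm (x ^ 4 * f\<^sup>2 * (f - 1)\<^sup>2) \<le> r ^ 4 * g\<^sup>2 * (g - 1)\<^sup>2"
        unfolding norm_mult norm_power r_def using f g1 by (intro mult_mono power_mono) auto
      moreover have "norm (4 * x ^ 3 * f) \<le> 4 * r ^ 3 * g"
        unfolding norm_mult norm_power r_def using f by (simp add: mult_left_mono)
      ultimately have "norm (x ^ 4 * f\<^sup>2 * (f - 1)\<^sup>2 + 4 * x ^ 3 * f) \<le> r ^ 4 * g\<^sup>2 * (g - 1)\<^sup>2 + 4 * r ^ 3 * g"
        by (intro norm_triangle_mono)
      then show ?thesis unfolding norm_mult[of 3] by simp
    qed
  qed (use u r g1 in auto)
  \<comment> \<open>Here \<open>K = 4 * D - p^2\<close> and \<open>p^2 > D\<close>. The resulting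
    ratio below 3/4 leaves more than 1/4 for \<open>p'^2 / (4 * D')\<close>.\<close>
  also have "K < 3 * D" using K pD_pos by simp
  finally have "norm (4 * D' - p'\<^sup>2) < 3 * norm D'" using D'_norm by simp
  moreover have D'0: "D' \<noteq> 0" using D'_norm D by auto
  ultimately have "norm ((4 * D' - p'\<^sup>2) / (4 * D')) < 3/4"
    by (simp add: norm_divide norm_mult field_simps)
  then have "Re ((4 * D' - p'\<^sup>2) / (4 * D')) < 3/4"
    using complex_Re_le_cmod le_less_trans by blast
  then have "Re (p'\<^sup>2 / (4 * D')) > 1/4"
    using D'0 by (simp add: diff_divide_distrib)
  then show "Re ((2 - x - 3 * x * f\<^sup>2)\<^sup>2 / (4 * (1 - 4 * x - 2 * x\<^sup>2))) > 1/4"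
    by (simp add: p'_def D'_def)
qed

section \<open>Convergence and majorants\<close>

text \<open>The truncated Cauchy product sums over the triangle \<open>i + j <= N\<close>, which
  lies inside the square of the product of partial sums.\<close>

lemma sum_fps_mult_nth_le:
  fixes A B :: "real fps"
  assumes "\<And>n. fps_nth A n \<ge> 0" "\<And>n. fps_nth B n \<ge> 0" "r \<ge> 0"
  shows "(\<Sum>n\<le>N. fps_nth (A * B) n * r ^ n)
    \<le> (\<Sum>n\<le>N. fps_nth A n * r ^ n) * (\<Sum>n\<le>N. fps_nth B n * r ^ n)"
proof -
  let ?a = "\<lambda>n. fps_nth A n * r ^ n" and ?b = "\<lambda>n. fps_nth B n * r ^ n"
  have "fps_nth (A * B) n * r ^ n = (\<Sum>i\<le>n. ?a i * ?b (n - i))" for n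
    unfolding fps_mult_nth sum_distrib_right atMost_atLeast0
  proof (rule sum.cong)
    fix i assume "i \<in> {0..n}"
    then have "r ^ n = r ^ i * r ^ (n - i)" by (simp flip: power_add)
    then show "fps_nth A i * fps_nth B (n - i) * r ^ n = ?a i * ?b (n - i)" by simp
  qed simp
  then have "(\<Sum>n\<le>N. fps_nth (A * B) n * r ^ n) = (\<Sum>n\<le>N. \<Sum>i\<le>n. ?a i * ?b (n - i))"
    by simp
  also have "\<dots> = (\<Sum>(i, j)\<in>{(i, j). i + j \<le> N}. ?a i * ?b j)"
    by (rule sum.triangle_reindex_eq[symmetric])
  also have "\<dots> \<le> (\<Sum>(i, j)\<in>{..N} \<times> {..N}. ?a i * ?b j)"
    using assms by (intro sum_mono2) auto
  also have "\<dots> = (\<Sum>n\<le>N. ?a n) * (\<Sum>n\<le>N. ?b n)"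
    by (simp add: sum_product sum.cartesian_product)
  finally show ?thesis .
qed

lemma norm_eval_fps_le:
  fixes F :: "complex fps"
  assumes nonneg: "\<And>n. \<exists>c\<ge>0. fps_nth F n = of_real c"
    and x: "ereal (norm x) < fps_conv_radius F"
  shows "norm (eval_fps F x) \<le> Re (eval_fps F (of_real (norm x)))"
    and "eval_fps F (of_real (norm x)) = of_real (Re (eval_fps F (of_real (norm x))))"
proof -
  obtain c where c: "\<And>n. c n \<ge> 0" "\<And>n. fps_nth F n = of_real (c n)"
    using nonneg by metis
  have nx: "norm (fps_nth F n * x ^ n) = c n * norm x ^ n" for n
    by (simp add: c norm_mult norm_power)
  have sm: "summable (\<lambda>n. c n * norm x ^ n)"
    using norm_summable_fps[OF x] by (simp add: nx)
  have ev: "eval_fps F (of_real (norm x)) = of_real (\<Sum>n. c n * norm x ^ n)"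
    using suminf_of_real[OF sm, where 'a = complex] by (simp add: eval_fps_def c)
  then show "eval_fps F (of_real (norm x)) = of_real (Re (eval_fps F (of_real (norm x))))"
    by simp
  have "norm (eval_fps F x) \<le> (\<Sum>n. norm (fps_nth F n * x ^ n))"
    unfolding eval_fps_def using sm by (intro summable_norm) (simp add: nx)
  then show "norm (eval_fps F x) \<le> Re (eval_fps F (of_real (norm x)))"
    by (simp add: ev nx)
qed

lemma F021_nth: "fps_nth F021 n = of_nat (w021 n)"
  by (simp add: F021_def)

text \<open>The partial sums stay below 2 because \<open>s \<mapsto> 1 + r s + r s\<^sup>3\<close> maps $[0,2]$ into itself for
  \<open>r = 1/10\<close>.\<close>

lemma sum_w021_le: "(\<Sum>n\<le>N. real (w021 n) * (1/10) ^ n) \<le> 2"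
proof (induction N)
  case 0
  then show ?case by (simp add: w021_0)
next
  case (Suc N)
  let ?r = "1/10 :: real"
  define W :: "real fps" where "W = Abs_fps (\<lambda>n. real (w021 n))"
  define S where "S = (\<Sum>n\<le>N. real (w021 n) * ?r ^ n)"
  have W_nth: "fps_nth W n = real (w021 n)" for n by (simp add: W_def)
  then have W: "fps_nth W n \<ge> 0" for n by simp
  then have WW: "fps_nth (W * W) n \<ge> 0" for n
    by (auto simp: fps_mult_nth intro!: sum_nonneg)
  have S: "S = (\<Sum>n\<le>N. fps_nth W n * ?r ^ n)" by (simp add: S_def W_def)
  \<comment> \<open>Coefficients of \<open>F = 1 + X (F + F^3 - F^2)\<close>, with the negative term
    dropped.\<close>
  have rec: "real (w021 (Suc n)) \<le> real (w021 n) + fps_nth (W * W * W) n" for n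
  proof -
    have FF: "fps_nth (F021 * F021) n = of_real (fps_nth (W * W) n)" for n
      by (simp add: fps_mult_nth[of F021] fps_mult_nth[of W] F021_nth W_nth)
    have FFF: "fps_nth (F021 * F021 * F021) n = of_real (fps_nth (W * W * W) n)" for n
      by (simp add: fps_mult_nth[of "F021 * F021"] fps_mult_nth[of "W * W"] FF F021_nth W_nth)
    have "F021 = 1 + fps_X * (F021 + F021 * F021 * F021 - F021 * F021)"
      using F021_functional_equation by (simp add: algebra_simps power2_eq_square)
    then have "fps_nth F021 (Suc n) = fps_nth (1 + fps_X * (F021 + F021 * F021 * F021 - F021 * F021)) (Suc n)"
      by simp
    then have "of_nat (w021 (Suc n))
        = complex_of_real (real (w021 n) + fps_nth (W * W * W) n - fps_nth (W * W) n)"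
      by (simp add: F021_nth FF FFF)
    then have "real (w021 (Suc n)) = real (w021 n) + fps_nth (W * W * W) n - fps_nth (W * W) n"
      by (metis of_real_eq_iff of_real_of_nat_eq)
    then show ?thesis using WW[of n] by simp
  qed
  have S0: "0 \<le> S" by (auto simp: S_def intro!: sum_nonneg)
  have "(\<Sum>n\<le>N. fps_nth (W * W * W) n * ?r ^ n) \<le> (\<Sum>n\<le>N. fps_nth (W * W) n * ?r ^ n) * S"
    unfolding S by (rule sum_fps_mult_nth_le) (use W WW in auto)
  also have "\<dots> \<le> (S * S) * S"
    using S0 sum_fps_mult_nth_le[of W W ?r N] W
    by (intro mult_right_mono) (auto simp: S)
  also have "\<dots> \<le> (2 * 2) * 2"
    using S0 Suc.IH by (intro mult_mono) (auto simp: S_def)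
  finally have W3: "(\<Sum>n\<le>N. fps_nth (W * W * W) n * ?r ^ n) \<le> 8" by simp
  have "(\<Sum>n\<le>Suc N. real (w021 n) * ?r ^ n) = 1 + (\<Sum>n\<le>N. real (w021 (Suc n)) * ?r ^ Suc n)"
    by (subst sum.atMost_Suc_shift) (simp add: w021_0)
  moreover have "(\<Sum>n\<le>N. real (w021 (Suc n)) * ?r ^ Suc n) = ?r * (\<Sum>n\<le>N. real (w021 (Suc n)) * ?r ^ n)"
    by (simp add: sum_distrib_left mult_ac)
  moreover have "(\<Sum>n\<le>N. real (w021 (Suc n)) * ?r ^ n)
      \<le> (\<Sum>n\<le>N. (real (w021 n) + fps_nth (W * W * W) n) * ?r ^ n)"
    using rec by (intro sum_mono mult_right_mono) auto
  moreover have "(\<Sum>n\<le>N. (real (w021 n) + fps_nth (W * W * W) n) * ?r ^ n)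
      = S + (\<Sum>n\<le>N. fps_nth (W * W * W) n * ?r ^ n)"
    by (simp add: S_def sum.distrib ring_distribs)
  ultimately show ?case using W3 Suc.IH[folded S_def] by linarith
qed

text \<open>The partial sums at 1/10 bound each term by 2, so at 1/20 a geometric series of ratio
  1/2 dominates.\<close>

lemma fps_conv_radius_F021_pos: "fps_conv_radius F021 > 0"
proof -
  have "norm (fps_nth F021 n * (1/20) ^ n) \<le> 2 * (1/2) ^ n" for n
  proof -
    have "real (w021 n) * (1/10) ^ n \<le> (\<Sum>k\<le>n. real (w021 k) * (1/10) ^ k)"
      by (intro member_le_sum) auto
    then have "real (w021 n) * (1/10) ^ n \<le> 2"
      using sum_w021_le[of n] by (rule order_trans)
    then have "real (w021 n) * (1/10) ^ n * (1/2) ^ n \<le> 2 * (1/2) ^ n"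
      by (rule mult_right_mono) simp
    moreover have "(1/10) ^ n * (1/2) ^ n = (1/20 :: real) ^ n"
      by (simp flip: power_mult_distrib)
    moreover have "norm (fps_nth F021 n * (1/20) ^ n) = real (w021 n) * (1/20) ^ n"
      by (simp add: F021_nth norm_mult norm_power norm_divide)
    ultimately show ?thesis by (simp only: mult.assoc)
  qed
  then have "summable (\<lambda>n. fps_nth F021 n * (1/20) ^ n)"
    by (rule summable_comparison_test'[OF summable_mult[OF summable_geometric], of "1/2" 0 _ 2, rotated]) simp
  then have "ereal (norm (1/20 :: complex)) \<le> fps_conv_radius F021"
    unfolding fps_conv_radius_def by (rule conv_radius_geI)
  then show ?thesis
    by (rule less_le_trans[rotated]) simp
qed

section \<open>From formal identities to values in the disc of convergence\<close>

theorem theorem2p6: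
  shows "F021 = 1 + fps_X * F021 / (1 - fps_X * F021 ^ 2)
    \<and> fps_conv_radius F021 > 0
    \<and> (\<forall>x :: complex. x \<noteq> 0 \<and> ereal (norm x) < fps_conv_radius F021 \<longrightarrow>
          eval_fps F021 x - 1 = - ((x * v0 x ^ 2 - v0 x + x + 1) / x))"
proof (intro conjI allI impI)
  have "(F021 - 1) * (1 - fps_X * F021\<^sup>2) = fps_X * F021"
    using F021_functional_equation by (simp add: algebra_simps)
  then have "fps_X * F021 / (1 - fps_X * F021\<^sup>2) = (F021 - 1) * (1 - fps_X * F021\<^sup>2) / (1 - fps_X * F021\<^sup>2)"
    by simp
  also have "\<dots> = F021 - 1"
  proof (rule nonzero_mult_div_cancel_right)
    have "fps_nth (1 - fps_X * F021\<^sup>2) 0 = 1" by simp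
    then show "1 - fps_X * F021\<^sup>2 \<noteq> 0" by fastforce
  qed
  finally show "F021 = 1 + fps_X * F021 / (1 - fps_X * F021 ^ 2)" by simp
next
  show "fps_conv_radius F021 > 0" by (rule fps_conv_radius_F021_pos)
next
  fix x :: complex assume x: "x \<noteq> 0 \<and> ereal (norm x) < fps_conv_radius F021"
  define y where "y = complex_of_real (norm x)"
  define G where "G = fps_deriv F021"
  define R where "R = min (fps_conv_radius F021) (fps_conv_radius G)"
  have "ereal (norm x) < fps_conv_radius G"
    using x fps_conv_radius_deriv[of F021] unfolding G_def by (metis less_le_trans)
  then have xR: "ereal (norm x) < R" and yR: "ereal (norm y) < R"
    using x by (simp_all add: R_def y_def)
  have cubic_fps: "fps_X * (F021 * F021 * F021) - fps_X * (F021 * F021) + (fps_X - 1) * F021 + 1 = 0"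
    using F021_functional_equation by (simp add: algebra_simps power2_eq_square)
  \<comment> \<open>Implicit differentiation of the cubic; it supplies the relation between
    \<open>g\<close> and \<open>g'\<close> at the point \<open>y = norm x\<close>.\<close>
  have "fps_deriv (fps_X * (F021 * F021 * F021) - fps_X * (F021 * F021) + (fps_X - 1) * F021 + 1) = 0"
    by (simp add: cubic_fps)
  then have deriv_fps: "G * (1 - fps_X + 2 * fps_X * F021 - 3 * fps_X * (F021 * F021))
      = F021 * F021 * F021 - F021 * F021 + F021"
    by (simp add: G_def algebra_simps)
  note conv = less_le_trans[OF _ fps_conv_radius_mult] less_le_trans[OF _ fps_conv_radius_add]
    less_le_trans[OF _ fps_conv_radius_diff]
  have conv_F: "ereal (norm z) < fps_conv_radius F021" "ereal (norm z) < fps_conv_radius G"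
    if "ereal (norm z) < R" for z :: complex
    using that by (auto simp: R_def)
  have cubic: "z * eval_fps F021 z ^ 3 - z * (eval_fps F021 z)\<^sup>2 + (z - 1) * eval_fps F021 z + 1 = 0"
    if "ereal (norm z) < R" for z
    using arg_cong[OF cubic_fps, of "\<lambda>A. eval_fps A z"] conv_F[OF that]
    by (simp add: eval_fps_add eval_fps_diff eval_fps_mult conv power2_eq_square power3_eq_cube)
  have deriv: "eval_fps G z * (1 - z + 2 * z * eval_fps F021 z - 3 * z * (eval_fps F021 z)\<^sup>2)
      = eval_fps F021 z ^ 3 - (eval_fps F021 z)\<^sup>2 + eval_fps F021 z"
    if "ereal (norm z) < R" for z
    using arg_cong[OF deriv_fps, of "\<lambda>A. eval_fps A z"] conv_F[OF that]
    by (simp add: eval_fps_add eval_fps_diff eval_fps_mult conv power2_eq_square power3_eq_cube)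
  define g where "g = Re (eval_fps F021 y)"
  define g' where "g' = Re (eval_fps G y)"
  have F_nonneg: "\<exists>c\<ge>0. fps_nth F021 n = of_real c" for n
    by (rule exI[of _ "real (w021 n)"]) (simp add: F021_nth)
  have F1_nonneg: "\<exists>c\<ge>0. fps_nth (F021 - 1) n = of_real c" for n
    using F_nonneg[of n] by (cases n) (auto simp: F021_nth w021_0)
  have G_nonneg: "\<exists>c\<ge>0. fps_nth G n = of_real c" for n
    by (rule exI[of _ "real (Suc n * w021 (Suc n))"]) (simp add: G_def F021_nth algebra_simps)
  have F1_eval: "eval_fps (F021 - 1) z = eval_fps F021 z - 1" if "ereal (norm z) < R" for z
    using conv_F[OF that] by (simp add: eval_fps_diff)
  have F1_conv: "ereal (norm x) < fps_conv_radius (F021 - 1)"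
    using conv_F[OF xR] by (intro conv) simp
  have f: "norm (eval_fps F021 x) \<le> g" "eval_fps F021 y = of_real g"
    using norm_eval_fps_le[OF F_nonneg conv_F(1)[OF xR]] by (simp_all add: g_def y_def)
  have f1: "norm (eval_fps F021 x - 1) \<le> g - 1"
    using norm_eval_fps_le(1)[OF F1_nonneg F1_conv] F1_eval[OF xR] F1_eval[OF yR]
    by (simp add: g_def y_def)
  have f': "g' \<ge> 0" "eval_fps G y = of_real g'"
    using norm_eval_fps_le[OF G_nonneg conv_F(2)[OF xR]] order_trans[OF norm_ge_zero]
    by (auto simp: g'_def y_def)
  have "complex_of_real (norm x * g ^ 3 - norm x * g\<^sup>2 + (norm x - 1) * g + 1) = 0"
    using cubic[OF yR] unfolding f(2) by (simp add: y_def)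
  then have cubic_r: "norm x * g ^ 3 - norm x * g\<^sup>2 + (norm x - 1) * g + 1 = 0"
    by (simp only: of_real_eq_0_iff)
  have "complex_of_real (g' * (1 - norm x + 2 * norm x * g - 3 * norm x * g\<^sup>2))
      = complex_of_real (g ^ 3 - g\<^sup>2 + g)"
    using deriv[OF yR] unfolding f(2) f'(2) by (simp add: y_def)
  then have deriv_r: "g' * (1 - norm x + 2 * norm x * g - 3 * norm x * g\<^sup>2) = g ^ 3 - g\<^sup>2 + g"
    by (simp only: of_real_eq_iff)
  have "g \<ge> 1" using order_trans[OF norm_ge_zero f1] by simp
  with x have "v0 x = (1 - x * (eval_fps F021 x)\<^sup>2) / x"
    by (intro v0_eq v0_series_bounds[OF _ cubic[OF xR] cubic_r deriv_r f'(1) _ f(1) f1] cubic[OF xR])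
       auto
  with x show "eval_fps F021 x - 1 = - ((x * v0 x ^ 2 - v0 x + x + 1) / x)"
    by (intro kernel_root_to_series cubic[OF xR]) auto
qed

end
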